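(* Let $\tau,\beta>0$, let $\alpha\in\mathbb{R}$ and let $A$ be the one-neighbor circulant matrix generated by the vector $a=(0,\alpha,0,\dots,0)\in\mathbb{R}^N$. Let $(\eta_j)_{j\in\{1,\dots,N\}}\in\mathbb{R}^N$ and, for $\varepsilon\in\mathbb{R}$, let $\beta_j=\beta_j(\varepsilon)=\beta+\varepsilon\eta_j$ for all $j\in\{1,\dots,N\}$. Then there exists $\delta>0$ such that for all $\varepsilon\in(-\delta,\delta)$ there exists a heterogeneous rotational twisted state solution to $$\frac{d}{dt}z_j=\sum_{l=1}^N A_{jl}(z_l-z_j)+\frac1\tau\Bigl(1-\frac{|z_j|^2}{\beta_j^2}\Bigr)z_j,\qquad z_j\in\mathbb{C},\ j\in\{1,\dots,N\},$$ defined by $$z_j(t)=R_j\,e^{i(\tilde\omega t+\tilde\phi_j+\tilde\theta)},\qquad j\in\{1,\dots,N\},$$ for some $\tilde\omega\in\mathbb{R}$, $(R_j)_{j}\in(0,\infty)^N$, $(\tilde\phi_j)_{j}\in[0,2\pi]^N$ and $\tilde\theta\in\mathbb{S}$. Moreover, if $\alpha>0$, there exists $\tilde\delta\in(0,\delta]$ such that if $\varepsilon\in(-\tilde\delta,\tilde\delta)$, then this solution is stable.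
   Context: $\mathbb{S}=\mathbb{R}/2\pi\mathbb{Z}$. A matrix $A\in M_N(\mathbb{R})$ is circulant, generated by $a=(a_0,\dots,a_{N-1})$, if $A_{jl}=a_{(l-j)\bmod N}$ for all $j,l\in\{1,\dots,N\}$, with remainder in $\{0,\dots,N-1\}$. A heterogeneous rotational twisted state is a solution $z_j(t)=r_j(t)e^{i\theta_j(t)}$ for which there exist $\omega\in\mathbb{R}$, radii $R_j>0$ and phases $\theta_j^\infty\in\mathbb{S}$ such that for all $t\ge0$ and all $j$, $r_j(t)=R_j$ and $\theta_j(t)=\theta_j^\infty+\theta(t)$ with $\frac{d}{dt}\theta(t)=\omega$. Stability of such a state is understood as linear stability modulo global rotation: in polar coordinates $(r_j,\theta_j)_{j}$ and in the frame rotating at speed $\tilde\omega$, the state is a fixed point, and the $2N\times2N$ Jacobian there has $0$ as a simple eigenvalue (due to invariance under global rotation) and all other eigenvalues with strictly negative real part. *)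

theory Defs
  imports "HOL-Analysis.Analysis" "Jordan_Normal_Form.Char_Poly"
begin

(* Oscillators are indexed by 0,...,N-1 instead of 1,...,N; the entries of a circulant
   matrix depend only on l - j, so the shift does not change them. *)
definition circulant :: "nat \<Rightarrow> (nat \<Rightarrow> real) \<Rightarrow> real mat" where
  "circulant N a = mat N N (\<lambda>(j, l). a (nat ((int l - int j) mod int N)))"

definition oscillator_field ::
  "nat \<Rightarrow> real mat \<Rightarrow> real \<Rightarrow> (nat \<Rightarrow> real) \<Rightarrow> (nat \<Rightarrow> complex) \<Rightarrow> nat \<Rightarrow> complex" where
  "oscillator_field N A \<tau> b w j =
     (\<Sum>l<N. complex_of_real (A $$ (j, l)) * (w l - w j))
     + complex_of_real (1 / \<tau> * (1 - (cmod (w j))\<^sup>2 / (b j)\<^sup>2)) * w j"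

definition is_solution ::
  "nat \<Rightarrow> ((nat \<Rightarrow> complex) \<Rightarrow> nat \<Rightarrow> complex) \<Rightarrow> (real \<Rightarrow> nat \<Rightarrow> complex) \<Rightarrow> bool" where
  "is_solution N F z \<longleftrightarrow>
     (\<forall>t\<ge>0. \<forall>j<N. ((\<lambda>s. z s j) has_vector_derivative F (z t) j) (at t within {0..}))"

(* Phases in the circle R/(2 pi Z) are given by real representatives; they only enter
   through cis. *)
definition heterogeneous_rotational_twisted_state ::
  "nat \<Rightarrow> ((nat \<Rightarrow> complex) \<Rightarrow> nat \<Rightarrow> complex) \<Rightarrow> (real \<Rightarrow> nat \<Rightarrow> complex) \<Rightarrow> bool" where
  "heterogeneous_rotational_twisted_state N F z \<longleftrightarrow>
     is_solution N F z \<and>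
     (\<exists>(\<omega>::real) (R :: nat \<Rightarrow> real) (\<phi> :: nat \<Rightarrow> real) (\<theta> :: real \<Rightarrow> real).
        (\<forall>j<N. R j > 0) \<and>
        (\<forall>t\<ge>0. (\<theta> has_real_derivative \<omega>) (at t within {0..})) \<and>
        (\<forall>t\<ge>0. \<forall>j<N. z t j = complex_of_real (R j) * cis (\<phi> j + \<theta> t)))"

(* Polar coordinates are stored in one vector x with r_j = x j and theta_j = x (N + j), j < N. *)
definition from_polar :: "nat \<Rightarrow> (nat \<Rightarrow> real) \<Rightarrow> nat \<Rightarrow> complex" where
  "from_polar N x j = complex_of_real (x j) * cis (x (N + j))"

(* The system z' = F z in polar coordinates, in the frame rotating at speed omega.
   From z_j = r_j exp (i theta_j) one gets exp (-i theta_j) F_j(z) = r_j' + i r_j theta_j'. *)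
definition rotating_polar_field ::
  "nat \<Rightarrow> ((nat \<Rightarrow> complex) \<Rightarrow> nat \<Rightarrow> complex) \<Rightarrow> real \<Rightarrow> (nat \<Rightarrow> real) \<Rightarrow> nat \<Rightarrow> real" where
  "rotating_polar_field N F \<omega> x i =
     (if i < N then Re (cis (- x (N + i)) * F (from_polar N x) i)
      else Im (cis (- x i) * F (from_polar N x) (i - N)) / x (i - N) - \<omega>)"

definition jacobian :: "nat \<Rightarrow> ((nat \<Rightarrow> real) \<Rightarrow> nat \<Rightarrow> real) \<Rightarrow> (nat \<Rightarrow> real) \<Rightarrow> real mat" where
  "jacobian n G x = mat n n (\<lambda>(i, k). deriv (\<lambda>s. G (x(k := s)) i) (x k))"

(* Linear stability modulo global rotation of the state with radii R, phases phi and speed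
   omega; simplicity of the eigenvalue 0 is algebraic. *)
definition stable_modulo_rotation ::
  "nat \<Rightarrow> ((nat \<Rightarrow> complex) \<Rightarrow> nat \<Rightarrow> complex) \<Rightarrow> real \<Rightarrow> (nat \<Rightarrow> real) \<Rightarrow> (nat \<Rightarrow> real) \<Rightarrow> bool" where
  "stable_modulo_rotation N F \<omega> R \<phi> \<longleftrightarrow>
     (let x = (\<lambda>k. if k < N then R k else \<phi> (k - N));
          G = rotating_polar_field N F \<omega>;
          J = map_mat complex_of_real (jacobian (2 * N) G x)
      in (\<forall>i<2 * N. G x i = 0) \<and>
         Polynomial.order 0 (char_poly J) = 1 \<and>
         (\<forall>\<mu>. eigenvalue J \<mu> \<and> \<mu> \<noteq> 0 \<longrightarrow> Re \<mu> < 0))"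

end

theory Submission
  imports Defs
begin

text \<open>The coupling is a directed ring: each oscillator feels only its successor. Suppose that all
  oscillators are at rest and all phases agree. Then only the radii remain, and for
  \<^term>\<open>\<alpha> \<noteq> 0\<close> the equation of the \<^term>\<open>j\<close>-th oscillator determines the next radius
  from the present one. Equilibria are therefore fixed points of a composition of \<^term>\<open>N\<close> real
  functions. For
  \<^term>\<open>\<epsilon> = 0\<close> the composition fixes \<^term>\<open>\<beta>\<close>, and if its derivative there is not 1, the
  intermediate value theorem gives a fixed point for small \<^term>\<open>\<epsilon>\<close>
  (\<open>periodic_orbit_of_perturbation\<close>). The derivative is the \<^term>\<open>N\<close>-th power of
  \<^term>\<open>1 + 2 / (\<alpha> * \<tau>)\<close>, which is 1 only for \<^term>\<open>\<alpha> * \<tau> = - 1\<close> and even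
  \<^term>\<open>N\<close>. In that case the same argument applies to the state in which neighbors are in
  anti-phase (\<open>aligned_equilibria_exist\<close>). For \<^term>\<open>\<alpha> = 0\<close> the radii are the
  \<^term>\<open>\<beta> + \<epsilon> * \<eta> j\<close>. Thus a state with angular velocity 0 and phases 0 or
  \<^term>\<open>pi\<close> always exists.\<close>

text \<open>For \<^term>\<open>\<alpha> > 0\<close> the state is in phase. There the Jacobian in polar coordinates splits
  into a radial and an angular block (\<open>jacobian_in_phase\<close>), each with nonzero entries only on the
  diagonal and at the positions of the successors. The determinant of such a matrix is a difference
  of two products (\<open>det_cyclic_bidiagonal\<close>), so an eigenvalue \<^term>\<open>\<mu>\<close> satisfies an equation
  between the product of the \<^term>\<open>\<mu> + b i\<close> and the product of positive numbers
  \<^term>\<open>a i \<le> b i\<close>. Comparing moduli excludes every \<^term>\<open>\<mu>\<close> in the closed right half plane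
  except a simple root 0 of the angular block (\<open>cyclic_char_poly_nonzero_right_half_plane\<close>,
  \<open>order_0_cyclic_char_poly\<close>).\<close>

section \<open>Cyclic bidiagonal matrices and their spectrum\<close>

definition cyclic_bidiagonal :: "nat \<Rightarrow> (nat \<Rightarrow> 'a :: zero) \<Rightarrow> (nat \<Rightarrow> 'a) \<Rightarrow> 'a mat" where
  "cyclic_bidiagonal N x a =
     mat N N (\<lambda>(i, k). if k = i then x i else if k = Suc i mod N then a i else 0)"

lemma cyclic_bidiagonal_carrier [simp]: "cyclic_bidiagonal N x a \<in> carrier_mat N N"
  by (simp add: cyclic_bidiagonal_def)

text \<open>Only two permutations contribute: the identity and the full cycle. Concretely, the first
  column has two nonzero entries, at the top and at the bottom, and deleting their rows leaves a
  triangular matrix in each case.\<close>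

lemma det_cyclic_bidiagonal:
  fixes x a :: "nat \<Rightarrow> 'a :: idom"
  assumes N: "N \<ge> 2"
  shows "det (cyclic_bidiagonal N x (\<lambda>i. - a i)) = (\<Prod>i<N. x i) - (\<Prod>i<N. a i)"
proof -
  obtain m where m: "N = Suc m" "m \<ge> 1"
    using N by (cases N) auto
  let ?A = "cyclic_bidiagonal N x (\<lambda>i. - a i)"
  have A: "?A \<in> carrier_mat N N" by (simp add: cyclic_bidiagonal_def)
  let ?U = "mat_delete ?A 0 0" and ?L = "mat_delete ?A m 0"
  have first: "det ?U = (\<Prod>i<m. x (Suc i))"
  proof -
    have "upper_triangular ?U"
      using m by (auto simp: upper_triangular_def mat_delete_def cyclic_bidiagonal_def mod_Suc)
    moreover have "?U \<in> carrier_mat m m"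
      using m by (auto simp: mat_delete_def cyclic_bidiagonal_def)
    ultimately have "det ?U = prod_list (diag_mat ?U)"
      by (rule det_upper_triangular)
    also have "\<dots> = (\<Prod>i<m. x (Suc i))"
      using m by (auto simp: prod_list_diag_prod mat_delete_def cyclic_bidiagonal_def atLeast0LessThan
          intro!: prod.cong)
    finally show ?thesis .
  qed
  have last: "det ?L = (\<Prod>i<m. - a i)"
  proof -
    have "det ?L = prod_list (diag_mat ?L)"
      using m by (intro det_lower_triangular[where n = m])
        (auto simp: mat_delete_def cyclic_bidiagonal_def)
    also have "\<dots> = (\<Prod>i<m. - a i)"
      using m by (auto simp: prod_list_diag_prod mat_delete_def cyclic_bidiagonal_def atLeast0LessThan
          intro!: prod.cong)
    finally show ?thesis .
  qed
  have "det ?A = (\<Sum>i<N. ?A $$ (i, 0) * cofactor ?A i 0)"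
    using A m by (intro laplace_expansion_column) auto
  also have "\<dots> = (\<Sum>i\<in>{0, m}. ?A $$ (i, 0) * cofactor ?A i 0)"
    using m by (intro sum.mono_neutral_right) (auto simp: cyclic_bidiagonal_def mod_Suc split: if_splits)
  also have "\<dots> = x 0 * det ?U + (- a m) * ((- 1) ^ m * det ?L)"
    using m by (simp add: cofactor_def) (simp add: cyclic_bidiagonal_def)
  also have "(- a m) * ((- 1) ^ m * det ?L) = - (a m * ((- 1) ^ m * (- 1) ^ m * (\<Prod>i<m. a i)))"
    unfolding last by (simp add: prod_uminus)
  also have "\<dots> = - (a m * (\<Prod>i<m. a i))"
    by (simp add: power_mult_distrib[symmetric])
  also have "x 0 * det ?U + \<dots> = (\<Prod>i<N. x i) - (\<Prod>i<N. a i)"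
    unfolding first unfolding m(1) by (subst prod.lessThan_Suc_shift, subst prod.lessThan_Suc) simp
  finally show ?thesis .
qed

lemma char_poly_cyclic_bidiagonal:
  fixes b a :: "nat \<Rightarrow> 'a :: idom"
  assumes "N \<ge> 2"
  shows "char_poly (cyclic_bidiagonal N (\<lambda>i. - b i) a) = (\<Prod>i<N. [:b i, 1:]) - (\<Prod>i<N. [:a i:])"
proof -
  have "i \<noteq> Suc i mod N" if "i < N" for i
    using that assms by (auto simp: mod_Suc)
  then have "char_poly_matrix (cyclic_bidiagonal N (\<lambda>i. - b i) a) =
      cyclic_bidiagonal N (\<lambda>i. [:b i, 1:]) (\<lambda>i. - [:a i:])"
    by (intro eq_matI) (auto simp: char_poly_matrix_def cyclic_bidiagonal_def)
  then show ?thesis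
    using det_cyclic_bidiagonal[OF assms, of "\<lambda>i. [:b i, 1:]" "\<lambda>i. [:a i:]"]
    by (simp add: char_poly_def)
qed

lemma char_poly_block_diagonal:
  fixes B C :: "'a :: idom mat"
  assumes B: "B \<in> carrier_mat n n" and C: "C \<in> carrier_mat m m"
  shows "char_poly (four_block_mat B (0\<^sub>m n m) (0\<^sub>m m n) C) = char_poly B * char_poly C"
proof -
  have "char_poly_matrix (four_block_mat B (0\<^sub>m n m) (0\<^sub>m m n) C) =
      four_block_mat (char_poly_matrix B) (0\<^sub>m n m) (0\<^sub>m m n) (char_poly_matrix C)"
    using B C by (intro eq_matI) (auto simp: char_poly_matrix_def)
  then show ?thesis
    using det_four_block_mat_lower_left_zero[of "char_poly_matrix B" n "0\<^sub>m n m" m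
        "0\<^sub>m m n" "char_poly_matrix C"] B C
    by (simp add: char_poly_def)
qed

text \<open>If \<^term>\<open>\<mu>\<close> lies in the closed right half plane, then adding it to a positive number
  \<^term>\<open>b i\<close> does not decrease the modulus, and increases it strictly unless
  \<^term>\<open>\<mu> = 0\<close>, where strictness has to come from \<^term>\<open>a i < b i\<close>. So the two products differ in modulus.\<close>

lemma cyclic_char_poly_nonzero_right_half_plane:
  fixes \<mu> :: complex and a b :: "nat \<Rightarrow> real"
  assumes N: "N \<ge> 1"
    and a: "\<And>i. i < N \<Longrightarrow> 0 < a i" and b: "\<And>i. i < N \<Longrightarrow> a i \<le> b i"
    and \<mu>: "Re \<mu> \<ge> 0"
    and strict: "\<mu> \<noteq> 0 \<or> (\<forall>i<N. a i < b i)"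
  shows "poly ((\<Prod>i<N. [:complex_of_real (b i), 1:]) - (\<Prod>i<N. [:complex_of_real (a i):])) \<mu> \<noteq> 0"
proof -
  have larger: "a i < cmod (of_real (b i) + \<mu>)" if i: "i < N" for i
  proof (cases "\<mu> = 0 \<or> Re \<mu> > 0")
    case True
    have "a i < b i + Re \<mu>"
      using True strict i b[OF i] by auto
    also have "\<dots> \<le> cmod (of_real (b i) + \<mu>)"
      using complex_Re_le_cmod[of "of_real (b i) + \<mu>"] by simp
    finally show ?thesis .
  next
    case False
    then have "Re \<mu> = 0" "Im \<mu> \<noteq> 0"
      using \<mu> by (auto simp: complex_eq_iff)
    then have "(b i)\<^sup>2 < (cmod (of_real (b i) + \<mu>))\<^sup>2"
      by (simp add: cmod_power2)
    then have "b i < cmod (of_real (b i) + \<mu>)"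
      by (rule power_less_imp_less_base) simp
    then show ?thesis using b[OF i] by simp
  qed
  have "(\<Prod>i<N. a i) < (\<Prod>i<N. cmod (of_real (b i) + \<mu>))"
  proof (rule prod_mono_strict[of 0])
    show "0 \<in> {..<N}" using N by simp
    show "a 0 < cmod (of_real (b 0) + \<mu>)" using N by (intro larger) auto
  next
    fix i assume "i \<in> {..<N}"
    then show "0 \<le> a i \<and> a i \<le> cmod (of_real (b i) + \<mu>)"
      using larger[of i] a[of i] by auto
    show "0 < cmod (of_real (b i) + \<mu>)"
      using larger[of i] a[of i] \<open>i \<in> {..<N}\<close> by auto
  qed auto
  moreover have "(\<Prod>i<N. a i) = cmod (\<Prod>i<N. of_real (a i))"
    using a by (auto simp: prod_norm[symmetric] less_imp_le intro!: prod.cong)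
  moreover have "(\<Prod>i<N. cmod (of_real (b i) + \<mu>)) = cmod (\<Prod>i<N. of_real (b i) + \<mu>)"
    by (simp add: prod_norm)
  ultimately show ?thesis
    by (auto simp: poly_prod)
qed

text \<open>The root at 0 reflects the invariance under a common shift of all phases. It is simple
  because the derivative at 0 is a sum of products of positive numbers.\<close>

lemma order_0_cyclic_char_poly:
  fixes a :: "nat \<Rightarrow> real"
  assumes N: "N \<ge> 1" and a: "\<And>i. i < N \<Longrightarrow> 0 < a i"
  shows "Polynomial.order 0 ((\<Prod>i<N. [:complex_of_real (a i), 1:]) - (\<Prod>i<N. [:complex_of_real (a i):])) = 1"
    (is "Polynomial.order 0 ?p = 1")
proof -
  have const: "pderiv (\<Prod>i<N. [:complex_of_real (a i):]) = 0"
    by (subst pderiv_prod) (simp add: pderiv_pCons)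
  have "poly (pderiv ?p) 0 = (\<Sum>i<N. \<Prod>k\<in>{..<N} - {i}. of_real (a k))"
    by (simp add: pderiv_diff const pderiv_prod pderiv_pCons poly_sum poly_prod)
  also have "\<dots> = complex_of_real (\<Sum>i<N. \<Prod>k\<in>{..<N} - {i}. a k)"
    by simp
  finally have "poly (pderiv ?p) 0 = complex_of_real (\<Sum>i<N. \<Prod>k\<in>{..<N} - {i}. a k)" .
  moreover have "(\<Sum>i<N. \<Prod>k\<in>{..<N} - {i}. a k) > 0"
    using a N by (intro sum_pos prod_pos) (auto simp: lessThan_empty_iff)
  ultimately have d: "poly (pderiv ?p) 0 \<noteq> 0"
    by (metis less_irrefl of_real_eq_0_iff)
  then have "?p \<noteq> 0" by (metis pderiv_0 poly_0)
  moreover have "poly ?p 0 = 0"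
    by (simp add: poly_prod)
  ultimately have "Polynomial.order 0 ?p = Suc (Polynomial.order 0 (pderiv ?p))"
    by (rule order_pderiv)
  also have "Polynomial.order 0 (pderiv ?p) = 0"
    using d by (rule order_0I)
  finally show ?thesis by simp
qed

section \<open>Periodic orbits of perturbed one-dimensional recursions\<close>

primrec orbit :: "(nat \<Rightarrow> 'a \<Rightarrow> 'a) \<Rightarrow> nat \<Rightarrow> 'a \<Rightarrow> 'a" where
  "orbit g 0 r = r"
| "orbit g (Suc j) r = g j (orbit g j r)"

lemma orbit_fixed: "(\<And>j. g j \<rho> = \<rho>) \<Longrightarrow> orbit g j \<rho> = \<rho>"
  by (induction j) auto

text \<open>The return map of the unperturbed recursion fixes \<^term>\<open>\<rho>\<close> with derivative
  \<^term>\<open>L ^ N\<close>. As this is not 1, the displacement after \<^term>\<open>N\<close> steps changes sign at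
  \<^term>\<open>\<rho>\<close>; the sign change survives a small perturbation, and the intermediate value theorem
  gives a periodic orbit. By continuity its whole cycle stays near \<^term>\<open>\<rho>\<close>.\<close>

lemma periodic_orbit_of_perturbation:
  fixes g :: "real \<Rightarrow> nat \<Rightarrow> real \<Rightarrow> real"
  assumes joint: "\<And>j r. isCont (\<lambda>p. g (fst p) j (snd p)) (0, r)"
    and cont: "\<And>\<epsilon> j. continuous_on UNIV (g \<epsilon> j)"
    and base: "\<And>j. g 0 j \<rho> = \<rho>"
    and deriv: "\<And>j. (g 0 j has_real_derivative L) (at \<rho>)"
    and L: "L ^ N \<noteq> 1" and h: "h > 0"
  shows "\<exists>\<delta>>0. \<forall>\<epsilon>. \<bar>\<epsilon>\<bar> < \<delta> \<longrightarrow>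
           (\<exists>r. orbit (g \<epsilon>) N r = r \<and> (\<forall>j\<le>N. \<bar>orbit (g \<epsilon>) j r - \<rho>\<bar> < h))"
proof -
  have fixed: "orbit (g 0) j \<rho> = \<rho>" for j
    using base by (rule orbit_fixed)
  have orbit_joint: "isCont (\<lambda>p. orbit (g (fst p)) j (snd p)) (0, r)" for j r
  proof (induction j)
    case (Suc j)
    have "isCont (\<lambda>p. (fst p, orbit (g (fst p)) j (snd p))) (0, r)"
      by (intro continuous_intros Suc)
    then show ?case
      using continuous_within_compose3[where g = "\<lambda>p. g (fst p) j (snd p)"
          and f = "\<lambda>p. (fst p, orbit (g (fst p)) j (snd p))" and s = UNIV and x = "(0, r)"]
        joint by (simp add: isCont_o2)
  qed simp
  have orbit_cont: "continuous_on UNIV (orbit (g \<epsilon>) j)" for \<epsilon> j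
  proof (induction j)
    case (Suc j)
    have "continuous_on UNIV (\<lambda>r. g \<epsilon> j (orbit (g \<epsilon>) j r))"
      using continuous_on_compose2[OF cont Suc] by simp
    then show ?case by (simp add: fun_eq_iff)
  qed simp
  have orbit_deriv: "(orbit (g 0) j has_real_derivative L ^ j) (at \<rho>)" for j
  proof (induction j)
    case (Suc j)
    have "((\<lambda>r. g 0 j (orbit (g 0) j r)) has_real_derivative L * L ^ j) (at \<rho>)"
      using DERIV_chain2[of "g 0 j" L "orbit (g 0) j" \<rho>] Suc deriv[of j] fixed[of j] by simp
    then show ?case by (simp add: fun_eq_iff)
  qed simp
  \<comment> \<open>The factor \<^term>\<open>L ^ N - 1\<close> makes the derivative of the displacement positive, whichever
      side of 1 the multiplier lies on.\<close>
  define Q where "Q \<epsilon> r = (L ^ N - 1) * (orbit (g \<epsilon>) N r - r)" for \<epsilon> r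
  have Q0: "Q 0 \<rho> = 0"
    by (simp add: Q_def fixed)
  have Q_deriv: "(Q 0 has_real_derivative (L ^ N - 1) * (L ^ N - 1)) (at \<rho>)"
    unfolding Q_def by (intro DERIV_cmult DERIV_diff orbit_deriv DERIV_ident)
  have "(L ^ N - 1) * (L ^ N - 1) > 0"
    using L by (simp add: zero_less_mult_iff) linarith
  from has_real_derivative_pos_inc_right[OF Q_deriv this] has_real_derivative_pos_inc_left[OF Q_deriv this]
  obtain d d' where d: "d > 0" "\<And>s. 0 < s \<Longrightarrow> s < d \<Longrightarrow> 0 < Q 0 (\<rho> + s)"
    and d': "d' > 0" "\<And>s. 0 < s \<Longrightarrow> s < d' \<Longrightarrow> Q 0 (\<rho> - s) < 0"
    using Q0 by auto
  have "\<forall>\<^sub>F p in at (0, \<rho>). \<forall>j\<in>{..N}. \<bar>orbit (g (fst p)) j (snd p) - \<rho>\<bar> < h"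
  proof (intro eventually_ball_finite ballI)
    fix j
    have "((\<lambda>p. orbit (g (fst p)) j (snd p)) \<longlongrightarrow> \<rho>) (at (0, \<rho>))"
      using orbit_joint[of \<rho> j] by (simp add: isCont_def fixed)
    from tendstoD[OF this h] show "\<forall>\<^sub>F p in at (0, \<rho>). \<bar>orbit (g (fst p)) j (snd p) - \<rho>\<bar> < h"
      by (simp add: dist_real_def)
  qed simp
  then obtain e where e: "e > 0" and near:
    "\<And>p j. p \<noteq> (0, \<rho>) \<Longrightarrow> dist p (0, \<rho>) < e \<Longrightarrow> j \<le> N \<Longrightarrow> \<bar>orbit (g (fst p)) j (snd p) - \<rho>\<bar> < h"
    unfolding eventually_at by auto
  have near: "\<bar>orbit (g \<epsilon>) j r - \<rho>\<bar> < h" if "\<bar>\<epsilon>\<bar> < e / 2" "\<bar>r - \<rho>\<bar> < e / 2" "j \<le> N" for \<epsilon> r j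
  proof (cases "(\<epsilon>, r) = (0, \<rho>)")
    case True
    then show ?thesis using h by (simp add: fixed)
  next
    case False
    have "dist (\<epsilon>, r) (0, \<rho>) \<le> \<bar>\<epsilon>\<bar> + \<bar>r - \<rho>\<bar>"
      unfolding dist_Pair_Pair dist_real_def using sqrt_sum_squares_le_sum_abs[of "\<bar>\<epsilon>\<bar>" "\<bar>r - \<rho>\<bar>"] by simp
    also have "\<dots> < e" using that by simp
    finally show ?thesis using near[of "(\<epsilon>, r)" j] False that by simp
  qed
  define s where "s = min (min d d') (e / 2) / 2"
  have s: "0 < s" "s < d" "s < d'" "s < e / 2"
    using d(1) d'(1) e by (auto simp: s_def)
  have Q_cont: "isCont (\<lambda>\<epsilon>. Q \<epsilon> r) 0" for r
  proof -
    have "isCont (\<lambda>\<epsilon>. orbit (g \<epsilon>) N r) 0"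
      using isCont_o2[where f = "\<lambda>\<epsilon>. (\<epsilon>, r)" and a = 0 and g = "\<lambda>p. orbit (g (fst p)) N (snd p)"] orbit_joint[of r N]
      by (simp add: continuous_intros)
    then show ?thesis unfolding Q_def by (intro continuous_intros)
  qed
  have "\<forall>\<^sub>F \<epsilon> in at 0. 0 < Q \<epsilon> (\<rho> + s)"
    using Q_cont[of "\<rho> + s"] d(2)[OF s(1,2)] unfolding isCont_def by (rule order_tendstoD)
  moreover have "\<forall>\<^sub>F \<epsilon> in at 0. Q \<epsilon> (\<rho> - s) < 0"
    using Q_cont[of "\<rho> - s"] d'(2)[OF s(1,3)] unfolding isCont_def by (rule order_tendstoD)
  ultimately have "\<forall>\<^sub>F \<epsilon> in at 0. Q \<epsilon> (\<rho> - s) < 0 \<and> 0 < Q \<epsilon> (\<rho> + s)"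
    by eventually_elim auto
  then obtain \<delta> where \<delta>: "\<delta> > 0"
    "\<And>\<epsilon>. \<epsilon> \<noteq> 0 \<Longrightarrow> \<bar>\<epsilon>\<bar> < \<delta> \<Longrightarrow> Q \<epsilon> (\<rho> - s) < 0 \<and> 0 < Q \<epsilon> (\<rho> + s)"
    unfolding eventually_at by (auto simp: dist_real_def)
  have "\<exists>r. orbit (g \<epsilon>) N r = r \<and> (\<forall>j\<le>N. \<bar>orbit (g \<epsilon>) j r - \<rho>\<bar> < h)"
    if \<epsilon>: "\<bar>\<epsilon>\<bar> < min \<delta> (e / 2)" for \<epsilon>
  proof -
    have sign: "Q \<epsilon> (\<rho> - s) < 0 \<and> 0 < Q \<epsilon> (\<rho> + s)"
      using \<delta>(2)[of \<epsilon>] \<epsilon> d(2)[OF s(1,2)] d'(2)[OF s(1,3)] by (cases "\<epsilon> = 0") auto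
    have "continuous_on {\<rho> - s..\<rho> + s} (Q \<epsilon>)"
      unfolding Q_def by (intro continuous_intros continuous_on_subset[OF orbit_cont]) auto
    with sign s obtain r where r: "\<rho> - s \<le> r" "r \<le> \<rho> + s" "Q \<epsilon> r = 0"
      using IVT'[of "Q \<epsilon>" "\<rho> - s" 0 "\<rho> + s"] by auto
    have "orbit (g \<epsilon>) N r = r"
      using r(3) L by (simp add: Q_def)
    moreover have "\<bar>orbit (g \<epsilon>) j r - \<rho>\<bar> < h" if "j \<le> N" for j
    proof -
      have "\<bar>r - \<rho>\<bar> < e / 2" using r s by linarith
      then show ?thesis using near \<epsilon> that by simp
    qed
    ultimately show ?thesis by blast
  qed
  then show ?thesis
    using \<delta>(1) e by (intro exI[of _ "min \<delta> (e / 2)"]) auto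
qed

section \<open>Radii of aligned equilibria\<close>

text \<open>When the phase of each oscillator differs from that of its neighbor by 0 (then
  \<^term>\<open>\<sigma> = 1\<close>) or by \<^term>\<open>pi\<close> (then \<^term>\<open>\<sigma> = - 1\<close>), the equilibrium
  condition involves only the radii. For \<^term>\<open>\<alpha> \<noteq> 0\<close> it expresses the radius of the next
  oscillator through the present one, so equilibria are the \<^term>\<open>N\<close>-periodic orbits of a
  one-dimensional recursion. The nondegeneracy condition is on the multiplier of the constant
  orbit \<^term>\<open>\<rho>\<close> of the homogeneous system.\<close>

lemma aligned_equilibria_near_nondegenerate:
  fixes \<alpha> \<beta> \<tau> \<sigma> \<rho> :: real
  assumes "\<alpha> \<noteq> 0" "\<beta> > 0" "\<tau> > 0" and \<sigma>: "\<sigma> * \<sigma> = 1"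
    and base: "\<alpha> * (\<sigma> - 1) + 1 / \<tau> * (1 - \<rho>\<^sup>2 / \<beta>\<^sup>2) = 0"
    and nondegenerate: "(\<sigma> * (1 - (1 - 3 * \<rho>\<^sup>2 / \<beta>\<^sup>2) / (\<alpha> * \<tau>))) ^ N \<noteq> 1"
    and h: "h > 0"
  shows "\<exists>\<delta>>0. \<forall>\<epsilon>. \<bar>\<epsilon>\<bar> < \<delta> \<longrightarrow> (\<exists>R. \<forall>j<N. \<bar>R j - \<rho>\<bar> < h \<and>
           \<alpha> * (\<sigma> * R (Suc j mod N) - R j)
             + 1 / \<tau> * (1 - (R j)\<^sup>2 / (\<beta> + \<epsilon> * \<eta> j)\<^sup>2) * R j = 0)"
proof -
  define g where "g \<epsilon> j r = \<sigma> * (r - (1 - r\<^sup>2 / (\<beta> + \<epsilon> * \<eta> j)\<^sup>2) * r / (\<alpha> * \<tau>))" for \<epsilon> :: real and j :: nat and r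
  have step: "\<alpha> * (\<sigma> * g \<epsilon> j r - r) + 1 / \<tau> * (1 - r\<^sup>2 / (\<beta> + \<epsilon> * \<eta> j)\<^sup>2) * r = 0" for \<epsilon> j r
  proof -
    have "\<sigma> * g \<epsilon> j r = r - (1 - r\<^sup>2 / (\<beta> + \<epsilon> * \<eta> j)\<^sup>2) * r / (\<alpha> * \<tau>)"
      unfolding g_def mult.assoc[symmetric] \<sigma> by simp
    then have "\<alpha> * (\<sigma> * g \<epsilon> j r - r) = - (\<alpha> * ((1 - r\<^sup>2 / (\<beta> + \<epsilon> * \<eta> j)\<^sup>2) * r / (\<alpha> * \<tau>)))"
      by simp
    also have "\<dots> = - (1 / \<tau> * (1 - r\<^sup>2 / (\<beta> + \<epsilon> * \<eta> j)\<^sup>2) * r)"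
      using \<open>\<alpha> \<noteq> 0\<close> by simp
    finally show ?thesis by simp
  qed
  have "\<exists>\<delta>>0. \<forall>\<epsilon>. \<bar>\<epsilon>\<bar> < \<delta> \<longrightarrow>
      (\<exists>r. orbit (g \<epsilon>) N r = r \<and> (\<forall>j\<le>N. \<bar>orbit (g \<epsilon>) j r - \<rho>\<bar> < h))"
  proof (rule periodic_orbit_of_perturbation[OF _ _ _ _ nondegenerate h])
    show "isCont (\<lambda>p. g (fst p) j (snd p)) (0, r)" for j r
      unfolding g_def using \<open>\<beta> > 0\<close> assms(1,3) by (intro continuous_intros) auto
    show "continuous_on UNIV (g \<epsilon> j)" for \<epsilon> j
      unfolding g_def divide_inverse by (intro continuous_intros)
    show "g 0 j \<rho> = \<rho>" for j
    proof -
      have "1 - \<rho>\<^sup>2 / \<beta>\<^sup>2 = - \<alpha> * \<tau> * (\<sigma> - 1)"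
        using base \<open>\<tau> > 0\<close> by (simp add: field_simps)
      then have "g 0 j \<rho> = \<sigma> * (\<rho> - (- \<alpha> * \<tau> * (\<sigma> - 1)) * \<rho> / (\<alpha> * \<tau>))"
        by (simp add: g_def)
      also have "\<dots> = \<sigma> * \<sigma> * \<rho>"
        using assms(1,3) by (simp add: field_simps)
      finally show ?thesis using \<sigma> by simp
    qed
    show "(g 0 j has_real_derivative \<sigma> * (1 - (1 - 3 * \<rho>\<^sup>2 / \<beta>\<^sup>2) / (\<alpha> * \<tau>))) (at \<rho>)" for j
      unfolding g_def using assms(1-3)
      by (auto intro!: derivative_eq_intros simp: field_simps power2_eq_square)
  qed
  then obtain \<delta> where "\<delta> > 0" and \<delta>: "\<And>\<epsilon>. \<bar>\<epsilon>\<bar> < \<delta> \<Longrightarrow>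
      (\<exists>r. orbit (g \<epsilon>) N r = r \<and> (\<forall>j\<le>N. \<bar>orbit (g \<epsilon>) j r - \<rho>\<bar> < h))"
    by blast
  show ?thesis
  proof (intro exI[of _ \<delta>] conjI allI impI \<open>\<delta> > 0\<close>)
    fix \<epsilon> :: real assume "\<bar>\<epsilon>\<bar> < \<delta>"
    then obtain r where r: "orbit (g \<epsilon>) N r = r" "\<And>j. j \<le> N \<Longrightarrow> \<bar>orbit (g \<epsilon>) j r - \<rho>\<bar> < h"
      using \<delta> by blast
    have "orbit (g \<epsilon>) (Suc j mod N) r = g \<epsilon> j (orbit (g \<epsilon>) j r)" if "j < N" for j
      using that r(1) by (cases "Suc j = N") auto
    then show "\<exists>R. \<forall>j<N. \<bar>R j - \<rho>\<bar> < h \<and> \<alpha> * (\<sigma> * R (Suc j mod N) - R j)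
        + 1 / \<tau> * (1 - (R j)\<^sup>2 / (\<beta> + \<epsilon> * \<eta> j)\<^sup>2) * R j = 0"
      using r(2) step by (intro exI[of _ "\<lambda>j. orbit (g \<epsilon>) j r"]) auto
  qed
qed

lemma uniform_small_perturbation:
  fixes c :: real and \<eta> :: "nat \<Rightarrow> real"
  assumes "c > 0"
  shows "\<exists>\<delta>>0. \<forall>\<epsilon>. \<bar>\<epsilon>\<bar> < \<delta> \<longrightarrow> (\<forall>j<N. \<bar>\<epsilon> * \<eta> j\<bar> < c)"
proof -
  have "\<forall>\<^sub>F \<epsilon> in nhds (0::real). \<forall>j\<in>{..<N}. \<bar>\<epsilon> * \<eta> j\<bar> < c"
  proof (intro eventually_ball_finite ballI)
    fix j
    have "((\<lambda>\<epsilon>. \<bar>\<epsilon> * \<eta> j\<bar>) \<longlongrightarrow> \<bar>0 * \<eta> j\<bar>) (nhds (0::real))"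
      by (intro tendsto_intros filterlim_ident)
    then show "\<forall>\<^sub>F \<epsilon> in nhds (0::real). \<bar>\<epsilon> * \<eta> j\<bar> < c"
      using assms by (intro order_tendstoD(2)) auto
  qed simp
  then show ?thesis
    unfolding eventually_nhds_metric by (auto simp: dist_real_def)
qed

text \<open>Without coupling the radii are the \<^term>\<open>\<beta> + \<epsilon> * \<eta> j\<close>. Otherwise the in-phase state has
  multiplier \<^term>\<open>1 + 2 / (\<alpha> * \<tau>)\<close>, which is never 1; it degenerates only if it is
  \<^term>\<open>- 1\<close> and \<^term>\<open>N\<close> is even. In this exceptional case the anti-phase state exists
  and has multiplier 7.\<close>

lemma aligned_equilibria_exist:
  fixes \<alpha> \<beta> \<tau> :: real
  assumes "N \<ge> 1" "\<beta> > 0" "\<tau> > 0"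
  obtains \<sigma> \<rho> :: real where "\<sigma> = 1 \<or> \<sigma> = - 1 \<and> even N" "\<rho> > 0" "\<alpha> > 0 \<longrightarrow> \<sigma> = 1 \<and> \<rho> = \<beta>"
    "\<And>h. h > 0 \<Longrightarrow> \<exists>\<delta>>0. \<forall>\<epsilon>. \<bar>\<epsilon>\<bar> < \<delta> \<longrightarrow> (\<exists>R. \<forall>j<N. \<bar>R j - \<rho>\<bar> < h \<and>
           \<alpha> * (\<sigma> * R (Suc j mod N) - R j)
             + 1 / \<tau> * (1 - (R j)\<^sup>2 / (\<beta> + \<epsilon> * \<eta> j)\<^sup>2) * R j = 0)"
proof -
  consider "\<alpha> = 0" | "\<alpha> \<noteq> 0" "\<alpha> * \<tau> = - 1" "even N" | "\<alpha> \<noteq> 0" "\<alpha> * \<tau> \<noteq> - 1 \<or> odd N"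
    by auto
  then show ?thesis
  proof cases
    case 1
    have "\<exists>\<delta>>0. \<forall>\<epsilon>. \<bar>\<epsilon>\<bar> < \<delta> \<longrightarrow> (\<exists>R. \<forall>j<N. \<bar>R j - \<beta>\<bar> < h \<and>
           \<alpha> * (1 * R (Suc j mod N) - R j) + 1 / \<tau> * (1 - (R j)\<^sup>2 / (\<beta> + \<epsilon> * \<eta> j)\<^sup>2) * R j = 0)"
      if h: "h > 0" for h
    proof -
      obtain \<delta> where "\<delta> > 0" and \<delta>: "\<forall>\<epsilon>. \<bar>\<epsilon>\<bar> < \<delta> \<longrightarrow> (\<forall>j<N. \<bar>\<epsilon> * \<eta> j\<bar> < h)"
        using uniform_small_perturbation[OF h] by blast
      show ?thesis
      proof (intro exI[of _ \<delta>] conjI allI impI \<open>\<delta> > 0\<close>)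
        fix \<epsilon> :: real assume "\<bar>\<epsilon>\<bar> < \<delta>"
        with \<delta> 1 show "\<exists>R. \<forall>j<N. \<bar>R j - \<beta>\<bar> < h \<and> \<alpha> * (1 * R (Suc j mod N) - R j)
            + 1 / \<tau> * (1 - (R j)\<^sup>2 / (\<beta> + \<epsilon> * \<eta> j)\<^sup>2) * R j = 0"
          by (intro exI[of _ "\<lambda>j. \<beta> + \<epsilon> * \<eta> j"]) auto
      qed
    qed
    with assms show ?thesis by (intro that[of 1 \<beta>]) auto
  next
    case 2
    \<comment> \<open>For \<^term>\<open>\<alpha> * \<tau> = - 1\<close> the anti-phase condition reads
        \<^term>\<open>\<rho>\<^sup>2 / \<beta>\<^sup>2 = 1 - 2 * (\<alpha> * \<tau>)\<close>, that is, 3.\<close>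
    show ?thesis
    proof (rule that[of "- 1" "sqrt 3 * \<beta>"])
      have ne: "(sqrt 3 * \<beta>)\<^sup>2 / \<beta>\<^sup>2 = 3"
        using assms by (simp add: power_mult_distrib)
      have \<alpha>: "\<alpha> = - 1 / \<tau>" using 2 assms by (simp add: field_simps)
      show "\<alpha> > 0 \<longrightarrow> - 1 = (1::real) \<and> sqrt 3 * \<beta> = \<beta>"
        unfolding \<alpha> using assms by (simp add: zero_less_divide_iff)
      have "(- 1 * (1 - (1 - 3 * (sqrt 3 * \<beta>)\<^sup>2 / \<beta>\<^sup>2) / (\<alpha> * \<tau>))) ^ N = 7 ^ N"
        unfolding times_divide_eq_right[symmetric] ne 2(2) by simp
      moreover have "(7::real) ^ N > 1" using assms by (intro one_less_power) auto
      ultimately have nd: "(- 1 * (1 - (1 - 3 * (sqrt 3 * \<beta>)\<^sup>2 / \<beta>\<^sup>2) / (\<alpha> * \<tau>))) ^ N \<noteq> 1"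
        by linarith
      have base: "\<alpha> * (- 1 - 1) + 1 / \<tau> * (1 - (sqrt 3 * \<beta>)\<^sup>2 / \<beta>\<^sup>2) = 0"
        unfolding ne \<alpha> by simp
      show "\<exists>\<delta>>0. \<forall>\<epsilon>. \<bar>\<epsilon>\<bar> < \<delta> \<longrightarrow> (\<exists>R. \<forall>j<N. \<bar>R j - sqrt 3 * \<beta>\<bar> < h \<and>
           \<alpha> * (- 1 * R (Suc j mod N) - R j) + 1 / \<tau> * (1 - (R j)\<^sup>2 / (\<beta> + \<epsilon> * \<eta> j)\<^sup>2) * R j = 0)"
        if h: "h > 0" for h
        by (rule aligned_equilibria_near_nondegenerate[OF 2(1) assms(2,3) _ base nd h]) simp
    qed (use 2 assms in auto)
  next
    case 3
    show ?thesis
    proof (rule that[of 1 \<beta>])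
      have ne: "3 * \<beta>\<^sup>2 / \<beta>\<^sup>2 = 3" using assms by simp
      define L where "L = 1 + 2 / (\<alpha> * \<tau>)"
      have L_eq: "1 * (1 - (1 - 3 * \<beta>\<^sup>2 / \<beta>\<^sup>2) / (\<alpha> * \<tau>)) = L"
        unfolding ne L_def by simp
      have "L \<noteq> 1" using 3 assms by (simp add: L_def)
      moreover have "L \<noteq> - 1 \<or> odd N"
        using 3 assms by (auto simp: L_def field_simps)
      ultimately have "L ^ N \<noteq> 1"
      proof (intro notI)
        assume *: "L \<noteq> 1" "L \<noteq> - 1 \<or> odd N" "L ^ N = 1"
        then have "\<bar>L\<bar> = 1"
          using power_eq_1_iff[OF *(3)] assms(1) by auto
        with *(1) have "L = - 1" by linarith
        with * show False by simp
      qed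
      then have nd: "(1 * (1 - (1 - 3 * \<beta>\<^sup>2 / \<beta>\<^sup>2) / (\<alpha> * \<tau>))) ^ N \<noteq> 1"
        unfolding L_eq .
      show "\<exists>\<delta>>0. \<forall>\<epsilon>. \<bar>\<epsilon>\<bar> < \<delta> \<longrightarrow> (\<exists>R. \<forall>j<N. \<bar>R j - \<beta>\<bar> < h \<and>
           \<alpha> * (1 * R (Suc j mod N) - R j) + 1 / \<tau> * (1 - (R j)\<^sup>2 / (\<beta> + \<epsilon> * \<eta> j)\<^sup>2) * R j = 0)"
        if h: "h > 0" for h
        using assms by (intro aligned_equilibria_near_nondegenerate[OF 3(1) assms(2,3) _ _ nd h]) auto
    qed (use 3 assms in auto)
  qed
qed

section \<open>Aligned equilibria as twisted states\<close>

lemma oscillator_field_one_neighbor: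
  assumes N: "N \<ge> 2" and j: "j < N"
  shows "oscillator_field N (circulant N (\<lambda>k. if k = 1 then \<alpha> else 0)) \<tau> b w j =
    of_real \<alpha> * (w (Suc j mod N) - w j) + of_real (1 / \<tau> * (1 - (cmod (w j))\<^sup>2 / (b j)\<^sup>2)) * w j"
proof -
  have entry: "circulant N (\<lambda>k. if k = 1 then \<alpha> else 0) $$ (j, l) = (if l = Suc j mod N then \<alpha> else 0)"
    if l: "l < N" for l
  proof -
    have "nat ((int l - int j) mod int N) = 1 \<longleftrightarrow> (int l - int j) mod int N = 1"
      by auto
    also have "\<dots> \<longleftrightarrow> (int l - int j) mod int N = 1 mod int N"
      using N by simp
    also have "\<dots> \<longleftrightarrow> int l mod int N = (int j + 1) mod int N"
      by (simp add: mod_eq_dvd_iff algebra_simps)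
    also have "\<dots> \<longleftrightarrow> l = Suc j mod N"
      using l by (simp flip: of_nat_Suc of_nat_mod add: add.commute)
    finally show ?thesis
      using j l by (simp add: circulant_def)
  qed
  have "(\<Sum>l<N. of_real (circulant N (\<lambda>k. if k = 1 then \<alpha> else 0) $$ (j, l)) * (w l - w j)) =
      (\<Sum>l<N. if l = Suc j mod N then of_real \<alpha> * (w l - w j) else 0)"
    by (intro sum.cong) (simp_all add: entry del: One_nat_def)
  also have "\<dots> = of_real \<alpha> * (w (Suc j mod N) - w j)"
    using N by (simp add: sum.delta)
  finally show ?thesis
    by (simp add: oscillator_field_def)
qed

text \<open>In the anti-phase case the signs alternate along the ring, which is consistent at the closing
  step from \<^term>\<open>N - 1\<close> to 0 exactly when \<^term>\<open>N\<close> is even.\<close>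

lemma aligned_equilibrium_is_twisted_state:
  assumes N: "N \<ge> 2" and \<sigma>: "\<sigma> = 1 \<or> \<sigma> = - 1 \<and> even N"
    and pos: "\<And>j. j < N \<Longrightarrow> R j > 0"
    and eq: "\<And>j. j < N \<Longrightarrow> \<alpha> * (\<sigma> * R (Suc j mod N) - R j)
        + 1 / \<tau> * (1 - (R j)\<^sup>2 / (b j)\<^sup>2) * R j = 0"
    and \<phi>: "\<And>j. \<phi> j = (if \<sigma> = 1 \<or> even j then 0 else pi)"
  shows "heterogeneous_rotational_twisted_state N
     (oscillator_field N (circulant N (\<lambda>k. if k = 1 then \<alpha> else 0)) \<tau> b)
     (\<lambda>t j. of_real (R j) * cis (0 * t + \<phi> j + 0))"
proof -
  let ?F = "oscillator_field N (circulant N (\<lambda>k. if k = 1 then \<alpha> else 0)) \<tau> b"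
  define w where "w j = complex_of_real (\<sigma> ^ j * R j)" for j
  have w: "of_real (R j) * cis (0 * t + \<phi> j + 0) = w j" for j t
    using \<sigma> by (auto simp: w_def \<phi> uminus_power_if)
  have "?F w j = 0" if j: "j < N" for j
  proof -
    have "\<sigma> ^ (Suc j mod N) = \<sigma> * \<sigma> ^ j"
      using \<sigma> j by (cases "Suc j = N") (auto simp flip: power_Suc)
    moreover have "(cmod (w j))\<^sup>2 = (R j)\<^sup>2"
      using \<sigma> by (auto simp: w_def norm_mult norm_power)
    ultimately have "?F w j = of_real (\<sigma> ^ j * (\<alpha> * (\<sigma> * R (Suc j mod N) - R j)
        + 1 / \<tau> * (1 - (R j)\<^sup>2 / (b j)\<^sup>2) * R j))"
      unfolding oscillator_field_one_neighbor[OF N j] by (simp add: w_def algebra_simps)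
    then show ?thesis unfolding eq[OF j] by simp
  qed
  then have "is_solution N ?F (\<lambda>t. w)"
    by (simp add: is_solution_def)
  then show ?thesis
    unfolding heterogeneous_rotational_twisted_state_def w
    using pos w by (intro conjI exI[of _ 0] exI[of _ R] exI[of _ \<phi>] exI[of _ "\<lambda>t. 0"]) auto
qed

section \<open>Linearization at in-phase equilibria\<close>

context
  fixes N :: nat and \<alpha> \<tau> :: real and b :: "nat \<Rightarrow> real"
    and F :: "(nat \<Rightarrow> complex) \<Rightarrow> nat \<Rightarrow> complex"
  assumes N: "N \<ge> 2"
  defines "F \<equiv> oscillator_field N (circulant N (\<lambda>k. if k = 1 then \<alpha> else 0)) \<tau> b"
begin

text \<open>Multiplying by \<^term>\<open>cis (- x (N + i))\<close> makes every oscillator appear with its phase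
  relative to the \<^term>\<open>i\<close>-th one; real and imaginary parts then give the radial and the
  angular component.\<close>

lemma field_in_polar_frame:
  assumes i: "i < N"
  defines "s \<equiv> Suc i mod N"
  shows "cis (- x (N + i)) * F (from_polar N x) i =
    of_real \<alpha> * (of_real (x s) * cis (x (N + s) - x (N + i)) - of_real (x i))
      + of_real (1 / \<tau> * (1 - (x i)\<^sup>2 / (b i)\<^sup>2) * x i)"
proof -
  have rot: "cis (- x (N + i)) * from_polar N x m = of_real (x m) * cis (x (N + m) - x (N + i))" for m
    by (simp add: from_polar_def cis_mult mult.left_commute)
  have "cis (- x (N + i)) * F (from_polar N x) i =
      of_real \<alpha> * (cis (- x (N + i)) * from_polar N x s - cis (- x (N + i)) * from_polar N x i)
      + of_real (1 / \<tau> * (1 - (cmod (from_polar N x i))\<^sup>2 / (b i)\<^sup>2)) * (cis (- x (N + i)) * from_polar N x i)"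
    unfolding F_def oscillator_field_one_neighbor[OF N i] s_def by (simp add: algebra_simps)
  moreover have "(cmod (from_polar N x i))\<^sup>2 = (x i)\<^sup>2"
    by (simp add: from_polar_def norm_mult)
  ultimately show ?thesis
    unfolding rot by simp
qed

lemma polar_field_radial:
  assumes i: "i < N"
  shows "rotating_polar_field N F \<omega> x i =
    \<alpha> * (x (Suc i mod N) * cos (x (N + Suc i mod N) - x (N + i)) - x i)
      + 1 / \<tau> * (1 - (x i)\<^sup>2 / (b i)\<^sup>2) * x i"
  using i by (simp add: rotating_polar_field_def field_in_polar_frame)

lemma polar_field_angular:
  assumes i: "i < N"
  shows "rotating_polar_field N F \<omega> x (N + i) =
    \<alpha> * (x (Suc i mod N) * sin (x (N + Suc i mod N) - x (N + i))) / x i - \<omega>"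
  using i by (simp add: rotating_polar_field_def field_in_polar_frame)

text \<open>Keeping the coordinate \<^term>\<open>k\<close> of the partial derivative symbolic lets one application of
  the differentiation rules cover all columns of the Jacobian.\<close>

lemma coordinate_derivative:
  fixes x :: "nat \<Rightarrow> real"
  assumes "D = of_bool (m = k)"
  shows "((\<lambda>t. (x(k := t)) m) has_real_derivative D) (at (x k))"
  using assms by (cases "m = k") auto

lemma polar_field_radial_deriv:
  assumes i: "i < N" and aligned: "\<And>j. j < N \<Longrightarrow> x (N + j) = c"
  shows "deriv (\<lambda>t. rotating_polar_field N F \<omega> (x(k := t)) i) (x k) =
    \<alpha> * (of_bool (Suc i mod N = k) - of_bool (i = k))
      + 1 / \<tau> * (1 - 3 * (x i)\<^sup>2 / (b i)\<^sup>2) * of_bool (i = k)"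
proof (rule DERIV_imp_deriv)
  have [simp]: "x (N + Suc i mod N) - x (N + i) = 0"
    using aligned N i by auto
  show "((\<lambda>t. rotating_polar_field N F \<omega> (x(k := t)) i) has_real_derivative
    \<alpha> * (of_bool (Suc i mod N = k) - of_bool (i = k))
      + 1 / \<tau> * (1 - 3 * (x i)\<^sup>2 / (b i)\<^sup>2) * of_bool (i = k)) (at (x k))"
    unfolding polar_field_radial[OF i] divide_inverse
    by ((rule coordinate_derivative derivative_eq_intros refl)+, simp)
      (cases "i = k"; simp add: algebra_simps power2_eq_square)
qed

lemma polar_field_angular_deriv:
  assumes i: "i < N" and aligned: "\<And>j. j < N \<Longrightarrow> x (N + j) = c" and pos: "x i > 0"
  shows "deriv (\<lambda>t. rotating_polar_field N F \<omega> (x(k := t)) (N + i)) (x k) =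
    \<alpha> * x (Suc i mod N) / x i * (of_bool (N + Suc i mod N = k) - of_bool (N + i = k))"
proof (rule DERIV_imp_deriv)
  have [simp]: "x (N + Suc i mod N) - x (N + i) = 0"
    using aligned N i by auto
  show "((\<lambda>t. rotating_polar_field N F \<omega> (x(k := t)) (N + i)) has_real_derivative
    \<alpha> * x (Suc i mod N) / x i * (of_bool (N + Suc i mod N = k) - of_bool (N + i = k))) (at (x k))"
    unfolding polar_field_angular[OF i]
    by (rule coordinate_derivative derivative_eq_intros refl | (use pos in simp; fail))+
qed

text \<open>At equal phases the sine of every phase difference vanishes, and so does the derivative of its
  cosine. Hence radii and phases decouple to first order.\<close>

lemma jacobian_in_phase:
  assumes aligned: "\<And>j. j < N \<Longrightarrow> x (N + j) = c" and pos: "\<And>j. j < N \<Longrightarrow> x j > 0"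
  defines "d \<equiv> (\<lambda>i. 1 / \<tau> * (1 - 3 * (x i)\<^sup>2 / (b i)\<^sup>2))"
    and "a \<equiv> (\<lambda>i. \<alpha> * x (Suc i mod N) / x i)"
  shows "jacobian (2 * N) (rotating_polar_field N F \<omega>) x =
    four_block_mat (cyclic_bidiagonal N (\<lambda>i. - (\<alpha> - d i)) (\<lambda>i. \<alpha>)) (0\<^sub>m N N) (0\<^sub>m N N)
      (cyclic_bidiagonal N (\<lambda>i. - a i) a)"
    (is "_ = ?B")
proof (rule eq_matI)
  show dims: "dim_row (jacobian (2 * N) (rotating_polar_field N F \<omega>) x) = dim_row ?B"
    "dim_col (jacobian (2 * N) (rotating_polar_field N F \<omega>) x) = dim_col ?B"
    by (simp_all add: jacobian_def cyclic_bidiagonal_def)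
  fix i k assume "i < dim_row ?B" "k < dim_col ?B"
  then have i: "i < 2 * N" and k: "k < 2 * N"
    by (simp_all add: cyclic_bidiagonal_def)
  have lt: "Suc m mod N < N" for m
    using N by simp
  have ne: "Suc m mod N \<noteq> m" if "m < N" for m
    using that N by (auto simp: mod_Suc)
  show "jacobian (2 * N) (rotating_polar_field N F \<omega>) x $$ (i, k) = ?B $$ (i, k)"
  proof (cases "i < N")
    case True
    have "jacobian (2 * N) (rotating_polar_field N F \<omega>) x $$ (i, k) =
        \<alpha> * (of_bool (Suc i mod N = k) - of_bool (i = k)) + d i * of_bool (i = k)"
      using i k polar_field_radial_deriv[OF True, where x = x and c = c, OF aligned] by (simp add: jacobian_def d_def)
    then show ?thesis
      using i k True lt[of i] ne[OF True] by (auto simp: cyclic_bidiagonal_def)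
  next
    case False
    define m where "m = i - N"
    have m: "i = N + m" "m < N" using False i by (auto simp: m_def)
    have "jacobian (2 * N) (rotating_polar_field N F \<omega>) x $$ (i, k) =
        a m * (of_bool (N + Suc m mod N = k) - of_bool (N + m = k))"
      using i k polar_field_angular_deriv[OF m(2), where x = x and c = c, OF aligned pos[OF m(2)]]
      by (simp add: jacobian_def a_def m(1))
    then show ?thesis
      using i k m lt[of m] ne[OF m(2)] by (auto simp: cyclic_bidiagonal_def)
  qed
qed

text \<open>Both diagonal blocks of the Jacobian are cyclic bidiagonal. In the radial block the diagonal
  entries exceed the coupling in modulus because every oscillator is contracting by itself, so it
  has no eigenvalue in the closed right half plane. In the angular block the couplings are
  positive and the rows sum to zero, so 0 is the only such eigenvalue, and it is simple.\<close>

lemma in_phase_equilibrium_stable: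
  assumes \<alpha>: "\<alpha> > 0"
    and pos: "\<And>j. j < N \<Longrightarrow> R j > 0"
    and eq: "\<And>j. j < N \<Longrightarrow> \<alpha> * (R (Suc j mod N) - R j)
        + 1 / \<tau> * (1 - (R j)\<^sup>2 / (b j)\<^sup>2) * R j = 0"
    and contracting: "\<And>j. j < N \<Longrightarrow> 1 / \<tau> * (1 - 3 * (R j)\<^sup>2 / (b j)\<^sup>2) < 0"
    and aligned: "\<And>j. j < N \<Longrightarrow> \<phi> j = c"
  shows "stable_modulo_rotation N F 0 R \<phi>"
proof -
  define x where "x = (\<lambda>k. if k < N then R k else \<phi> (k - N))"
  let ?G = "rotating_polar_field N F 0"
  define J where "J = map_mat complex_of_real (jacobian (2 * N) ?G x)"
  define d where "d = (\<lambda>i. 1 / \<tau> * (1 - 3 * (x i)\<^sup>2 / (b i)\<^sup>2))"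
  define a where "a = (\<lambda>i. \<alpha> * x (Suc i mod N) / x i)"
  have x_pos: "x j > 0" if "j < N" for j
    using that pos by (simp add: x_def)
  have x_aligned: "x (N + j) = c" if "j < N" for j
    using that aligned by (simp add: x_def)
  have lt: "Suc m mod N < N" for m
    using N by simp
  have fixed: "?G x i = 0" if i: "i < 2 * N" for i
  proof (cases "i < N")
    case True
    then show ?thesis
      using eq[OF True] lt[of i] by (simp add: polar_field_radial x_aligned) (simp add: x_def)
  next
    case False
    define m where "m = i - N"
    have m: "i = N + m" "m < N" using False i by (auto simp: m_def)
    then show ?thesis
      using lt[of m] by (simp add: polar_field_angular x_aligned)
  qed
  define P where "P = (\<Prod>i<N. [:complex_of_real (\<alpha> - d i), 1:]) - (\<Prod>i<N. [:complex_of_real \<alpha>:])"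
  define Q where "Q = (\<Prod>i<N. [:complex_of_real (a i), 1:]) - (\<Prod>i<N. [:complex_of_real (a i):])"
  have jacobian: "jacobian (2 * N) ?G x = four_block_mat
      (cyclic_bidiagonal N (\<lambda>i. - (\<alpha> - d i)) (\<lambda>i. \<alpha>)) (0\<^sub>m N N) (0\<^sub>m N N)
      (cyclic_bidiagonal N (\<lambda>i. - a i) a)"
    unfolding d_def a_def by (rule jacobian_in_phase[where x = x and c = c, OF x_aligned x_pos])
  have "J = four_block_mat
      (cyclic_bidiagonal N (\<lambda>i. - of_real (\<alpha> - d i)) (\<lambda>i. of_real \<alpha>)) (0\<^sub>m N N) (0\<^sub>m N N)
      (cyclic_bidiagonal N (\<lambda>i. - of_real (a i)) (\<lambda>i. of_real (a i)))"
    unfolding J_def jacobian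
    by (intro eq_matI) (auto simp: cyclic_bidiagonal_def)
  then have J: "char_poly J = P * Q"
    unfolding P_def Q_def
    by (simp only: char_poly_block_diagonal[OF cyclic_bidiagonal_carrier cyclic_bidiagonal_carrier]
        char_poly_cyclic_bidiagonal[OF N])
  have a_pos: "a i > 0" if "i < N" for i
    using that \<alpha> x_pos lt by (simp add: a_def)
  have d_neg: "d i < 0" if "i < N" for i
    using that contracting[OF that] by (simp add: d_def x_def)
  have P: "poly P \<mu> \<noteq> 0" if "Re \<mu> \<ge> 0" for \<mu>
    unfolding P_def
    by (rule cyclic_char_poly_nonzero_right_half_plane) (use N \<alpha> d_neg that in \<open>auto simp: less_imp_le\<close>)
  have Q: "poly Q \<mu> \<noteq> 0" if "Re \<mu> \<ge> 0" "\<mu> \<noteq> 0" for \<mu>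
    unfolding Q_def
    by (rule cyclic_char_poly_nonzero_right_half_plane) (use N a_pos that in auto)
  have "Polynomial.order 0 Q = 1"
    unfolding Q_def by (rule order_0_cyclic_char_poly) (use N a_pos in auto)
  moreover have "Polynomial.order 0 P = 0"
    using P[of 0] by (intro order_0I) simp
  moreover have "P * Q \<noteq> 0"
    using P[of 1] Q[of 1] by auto
  ultimately have simple: "Polynomial.order 0 (char_poly J) = 1"
    unfolding J by (simp add: order_mult)
  have "Re \<mu> < 0" if "eigenvalue J \<mu>" "\<mu> \<noteq> 0" for \<mu>
  proof -
    have "J \<in> carrier_mat (2 * N) (2 * N)" by (simp add: J_def jacobian_def)
    then have "poly (P * Q) \<mu> = 0"
      using that(1) eigenvalue_root_char_poly J by metis
    then show ?thesis
      using P[of \<mu>] Q[of \<mu>] that(2) by (auto simp: not_le[symmetric])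
  qed
  with fixed simple show ?thesis
    unfolding stable_modulo_rotation_def Let_def J_def x_def by auto
qed

end

section \<open>Existence and stability\<close>

theorem theorem3:
  fixes N :: nat and \<tau> \<beta> \<alpha> :: real and \<eta> :: "nat \<Rightarrow> real" and A :: "real mat"
    and F :: "real \<Rightarrow> (nat \<Rightarrow> complex) \<Rightarrow> nat \<Rightarrow> complex"
  assumes N: "N \<ge> 2"
    and "\<tau> > 0" and "\<beta> > 0"
    and A: "A = circulant N (\<lambda>k. if k = 1 then \<alpha> else 0)"
    and F: "\<And>\<epsilon>. F \<epsilon> = oscillator_field N A \<tau> (\<lambda>j. \<beta> + \<epsilon> * \<eta> j)"
  shows "\<exists>\<delta>>0. \<exists>(\<omega> :: real \<Rightarrow> real) (R :: real \<Rightarrow> nat \<Rightarrow> real)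
            (\<phi> :: real \<Rightarrow> nat \<Rightarrow> real) (\<theta> :: real \<Rightarrow> real).
     (\<forall>\<epsilon>\<in>{-\<delta><..<\<delta>}.
        (\<forall>j<N. R \<epsilon> j > 0 \<and> \<phi> \<epsilon> j \<in> {0..2 * pi}) \<and>
        heterogeneous_rotational_twisted_state N (F \<epsilon>)
          (\<lambda>t j. complex_of_real (R \<epsilon> j) * cis (\<omega> \<epsilon> * t + \<phi> \<epsilon> j + \<theta> \<epsilon>))) \<and>
     (\<alpha> > 0 \<longrightarrow>
        (\<exists>\<delta>'>0. \<delta>' \<le> \<delta> \<and>
           (\<forall>\<epsilon>\<in>{-\<delta>'<..<\<delta>'}.
              stable_modulo_rotation N (F \<epsilon>) (\<omega> \<epsilon>) (R \<epsilon>) (\<lambda>j. \<phi> \<epsilon> j + \<theta> \<epsilon>))))"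
proof -
  have "N \<ge> 1" using N by simp
  then obtain \<sigma> \<rho> where \<sigma>: "\<sigma> = 1 \<or> \<sigma> = - 1 \<and> even N" and "\<rho> > 0"
    and attractive: "\<alpha> > 0 \<longrightarrow> \<sigma> = 1 \<and> \<rho> = \<beta>"
    and near: "\<And>h. h > 0 \<Longrightarrow> \<exists>\<delta>>0. \<forall>\<epsilon>. \<bar>\<epsilon>\<bar> < \<delta> \<longrightarrow> (\<exists>R. \<forall>j<N. \<bar>R j - \<rho>\<bar> < h \<and>
           \<alpha> * (\<sigma> * R (Suc j mod N) - R j)
             + 1 / \<tau> * (1 - (R j)\<^sup>2 / (\<beta> + \<epsilon> * \<eta> j)\<^sup>2) * R j = 0)"
    using aligned_equilibria_exist[OF _ \<open>\<beta> > 0\<close> \<open>\<tau> > 0\<close>, of N \<alpha> \<eta>] by blast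
  \<comment> \<open>The radii and the \<^term>\<open>\<beta> + \<epsilon> * \<eta> j\<close> are kept within a quarter of their unperturbed values:
      then radii are positive and, in the in-phase case, exceed
      \<^term>\<open>(\<beta> + \<epsilon> * \<eta> j) / sqrt 3\<close>, above which the dynamics of a single oscillator contracts
      radially. This uses \<^term>\<open>3 * (3 / 4)\<^sup>2 > (5 / 4 :: real)\<^sup>2\<close>.\<close>
  obtain \<delta>1 where "\<delta>1 > 0" and "\<forall>\<epsilon>. \<bar>\<epsilon>\<bar> < \<delta>1 \<longrightarrow> (\<exists>R. \<forall>j<N. \<bar>R j - \<rho>\<bar> < \<rho> / 4 \<and>
           \<alpha> * (\<sigma> * R (Suc j mod N) - R j)
             + 1 / \<tau> * (1 - (R j)\<^sup>2 / (\<beta> + \<epsilon> * \<eta> j)\<^sup>2) * R j = 0)"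
    using near[of "\<rho> / 4"] \<open>\<rho> > 0\<close> by auto
  then obtain R where R: "\<And>\<epsilon> j. \<bar>\<epsilon>\<bar> < \<delta>1 \<Longrightarrow> j < N \<Longrightarrow> \<bar>R \<epsilon> j - \<rho>\<bar> < \<rho> / 4 \<and>
           \<alpha> * (\<sigma> * R \<epsilon> (Suc j mod N) - R \<epsilon> j)
             + 1 / \<tau> * (1 - (R \<epsilon> j)\<^sup>2 / (\<beta> + \<epsilon> * \<eta> j)\<^sup>2) * R \<epsilon> j = 0"
    by metis
  obtain \<delta>2 where "\<delta>2 > 0" and \<delta>2: "\<forall>\<epsilon>. \<bar>\<epsilon>\<bar> < \<delta>2 \<longrightarrow> (\<forall>j<N. \<bar>\<epsilon> * \<eta> j\<bar> < \<beta> / 4)"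
    using uniform_small_perturbation[of "\<beta> / 4" N \<eta>] \<open>\<beta> > 0\<close> by auto
  define \<delta> where "\<delta> = min \<delta>1 \<delta>2"
  define \<phi> :: "nat \<Rightarrow> real" where "\<phi> j = (if \<sigma> = 1 \<or> even j then 0 else pi)" for j
  have "\<delta> > 0" using \<open>\<delta>1 > 0\<close> \<open>\<delta>2 > 0\<close> by (simp add: \<delta>_def)
  have small: "\<bar>\<epsilon>\<bar> < \<delta>1" "\<bar>\<epsilon>\<bar> < \<delta>2" if "\<epsilon> \<in> {-\<delta><..<\<delta>}" for \<epsilon>
    using that unfolding \<delta>_def greaterThanLessThan_iff by linarith+
  have R_pos: "R \<epsilon> j > 0" if "\<epsilon> \<in> {-\<delta><..<\<delta>}" "j < N" for \<epsilon> j
    using R[OF small(1)[OF that(1)] that(2)] \<open>\<rho> > 0\<close> by linarith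
  have R_eq: "\<alpha> * (\<sigma> * R \<epsilon> (Suc j mod N) - R \<epsilon> j)
             + 1 / \<tau> * (1 - (R \<epsilon> j)\<^sup>2 / (\<beta> + \<epsilon> * \<eta> j)\<^sup>2) * R \<epsilon> j = 0"
    if "\<epsilon> \<in> {-\<delta><..<\<delta>}" "j < N" for \<epsilon> j
    using R[OF small(1)[OF that(1)] that(2)] by blast
  have twisted: "heterogeneous_rotational_twisted_state N (F \<epsilon>)
      (\<lambda>t j. complex_of_real (R \<epsilon> j) * cis (0 * t + \<phi> j + 0))" if "\<epsilon> \<in> {-\<delta><..<\<delta>}" for \<epsilon>
    unfolding F A
    by (rule aligned_equilibrium_is_twisted_state[where R = "R \<epsilon>" and \<phi> = \<phi> and \<sigma> = \<sigma> and \<alpha> = \<alpha>,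
          OF N \<sigma> R_pos[OF that] R_eq[OF that] \<phi>_def])
  have stable: "stable_modulo_rotation N (F \<epsilon>) 0 (R \<epsilon>) (\<lambda>j. \<phi> j + 0)"
    if \<epsilon>: "\<epsilon> \<in> {-\<delta><..<\<delta>}" and "\<alpha> > 0" for \<epsilon>
  proof -
    have [simp]: "\<sigma> = 1" "\<rho> = \<beta>" using attractive \<open>\<alpha> > 0\<close> by auto
    have contracting: "1 / \<tau> * (1 - 3 * (R \<epsilon> j)\<^sup>2 / (\<beta> + \<epsilon> * \<eta> j)\<^sup>2) < 0" if j: "j < N" for j
    proof -
      have "\<bar>\<epsilon> * \<eta> j\<bar> < \<beta> / 4" using \<delta>2 small(2)[OF \<epsilon>] j by blast
      then have b: "0 < \<beta> + \<epsilon> * \<eta> j" "\<beta> + \<epsilon> * \<eta> j < 5 / 4 * \<beta>"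
        using \<open>\<beta> > 0\<close> by linarith+
      have r: "3 / 4 * \<beta> < R \<epsilon> j"
        using R[OF small(1)[OF \<epsilon>] j] \<open>\<rho> = \<beta>\<close> by linarith
      have "(\<beta> + \<epsilon> * \<eta> j)\<^sup>2 \<le> (5 / 4 * \<beta>)\<^sup>2"
        using b by (intro power_mono) auto
      also have "\<dots> < 3 * (3 / 4 * \<beta>)\<^sup>2"
        using \<open>\<beta> > 0\<close> by (simp add: power2_eq_square)
      also have "\<dots> \<le> 3 * (R \<epsilon> j)\<^sup>2"
        using r \<open>\<beta> > 0\<close> by (intro mult_left_mono power_mono) auto
      finally have "1 < 3 * (R \<epsilon> j)\<^sup>2 / (\<beta> + \<epsilon> * \<eta> j)\<^sup>2"
        using b(1) by simp
      then show ?thesis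
        using \<open>\<tau> > 0\<close> by (simp add: mult_less_0_iff divide_less_0_iff)
    qed
    show ?thesis
      unfolding F A
    proof (rule in_phase_equilibrium_stable[where R = "R \<epsilon>" and c = 0, OF N \<open>\<alpha> > 0\<close> R_pos[OF \<epsilon>] _ contracting])
      show "\<alpha> * (R \<epsilon> (Suc j mod N) - R \<epsilon> j)
          + 1 / \<tau> * (1 - (R \<epsilon> j)\<^sup>2 / (\<beta> + \<epsilon> * \<eta> j)\<^sup>2) * R \<epsilon> j = 0" if "j < N" for j
        using R_eq[OF \<epsilon> that] by simp
      show "\<phi> j + 0 = 0" for j
        by (simp add: \<phi>_def)
    qed
  qed
  have range: "\<phi> j \<in> {0..2 * pi}" for j
    by (simp add: \<phi>_def)
  show ?thesis
  proof (rule exI[of _ \<delta>], intro conjI \<open>\<delta> > 0\<close>,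
      rule exI[of _ "\<lambda>_. 0"], rule exI[of _ R], rule exI[of _ "\<lambda>_. \<phi>"], rule exI[of _ "\<lambda>_. 0"],
      intro conjI ballI impI allI)
    show "\<exists>\<delta>'>0. \<delta>' \<le> \<delta> \<and> (\<forall>\<epsilon>\<in>{-\<delta>'<..<\<delta>'}.
        stable_modulo_rotation N (F \<epsilon>) 0 (R \<epsilon>) (\<lambda>j. \<phi> j + 0))" if "\<alpha> > 0"
      using \<open>\<delta> > 0\<close> stable that by (intro exI[of _ \<delta>]) auto
  qed (use R_pos twisted range in auto)
qed

end
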